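(* For a commutative hemiring $R$, the following conditions are equivalent: (i) $\mathcal{R}_{BM}(R)=0$; (ii) $\mathcal{R}_{\mathfrak{C}_s}(R)=0$; (iii) $R$ is semiisomorphic to a subdirect product of simple commutative semirings; (iv) $R$ is semiisomorphic to a subdirect product of semirings that are either fields or the semifield $\mathbf{B}$.
   Context: A hemiring $(R,+,\cdot,0)$ consists of a commutative monoid $(R,+,0)$ and a semigroup $(R,\cdot)$ such that multiplication distributes over addition on both sides and $0r=0=r0$ for all $r$. A semiring is a hemiring with a multiplicative identity $1$. Ideals are two-sided and are regarded as hemirings. A hemiring is commutative if its multiplication is commutative. A hemiring $R$ is ideal-simple if its only ideals are $0$ and $R$; congruence-simple if its only congruences are the diagonal and $R^2$; simple if it is both ideal-simple and congruence-simple. $\mathbf{B}=\{0,1\}$ is the Boolean semifield, with $1+1=1$. Brown-McCoy radical: let $\mathcal{U}\mathbb{S}$ be the class of all hemirings having no nonzero homomorphic image that is an ideal-simple semiring. $\mathcal{R}_{BM}(R)$ is the union of all ideals of $R$ belonging to $\mathcal{U}\mathbb{S}$ (it is the greatest such ideal). $\mathfrak{C}_s$ is the set of all congruences $\rho$ on $R$ such that $R/\rho$ is a nonzero simple semiring; for $\rho\in\mathfrak{C}_s$, $[0_\rho]:=\{r\in R\mid(r,0)\in\rho\}$; and $\mathcal{R}_{\mathfrak{C}_s}(R):=\bigcap\{[0_\rho]\mid\rho\in\mathfrak{C}_s\}$ (equal to $R$ if $\mathfrak{C}_s=\emptyset$). A semiisomorphism is a surjective hemiring homomorphism $f:R\to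 S$ with $\{a\mid f(a)=0\}=0$; $R$ is semiisomorphic to $S$ if there is a semiisomorphism $R\to S$. A subdirect product of hemirings $(R_i)_{i\in I}$ is a subhemiring $S$ of $\prod_{i\in I}R_i$ such that every projection restricted to $S$ is surjective onto $R_i$. *)

theory Defs
  imports "HOL-Algebra.Ring"
begin

section \<open>Hemirings, homomorphisms and ideals\<close>

text \<open>
  Hemirings reuse the record of HOL-Algebra rings. A hemiring need not have an identity, so the
  field \<^const>\<open>one\<close> of the record carries no meaning in this theory: no notion below depends on
  its value, and being a semiring or a field means that \<^emph>\<open>some\<close> choice of that field
  satisfies the corresponding HOL-Algebra locale.
\<close>

locale hemiring = abelian_monoid R for R (structure) +
  assumes mult_closed: "\<lbrakk> x \<in> carrier R; y \<in> carrier R \<rbrakk> \<Longrightarrow> x \<otimes> y \<in> carrier R"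
    and mult_assoc: "\<lbrakk> x \<in> carrier R; y \<in> carrier R; z \<in> carrier R \<rbrakk>
      \<Longrightarrow> (x \<otimes> y) \<otimes> z = x \<otimes> (y \<otimes> z)"
    and mult_add_left: "\<lbrakk> x \<in> carrier R; y \<in> carrier R; z \<in> carrier R \<rbrakk>
      \<Longrightarrow> (x \<oplus> y) \<otimes> z = x \<otimes> z \<oplus> y \<otimes> z"
    and mult_add_right: "\<lbrakk> x \<in> carrier R; y \<in> carrier R; z \<in> carrier R \<rbrakk>
      \<Longrightarrow> z \<otimes> (x \<oplus> y) = z \<otimes> x \<oplus> z \<otimes> y"
    and mult_zero_left: "x \<in> carrier R \<Longrightarrow> \<zero> \<otimes> x = \<zero>"
    and mult_zero_right: "x \<in> carrier R \<Longrightarrow> x \<otimes> \<zero> = \<zero>"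

locale comm_hemiring = hemiring R for R (structure) +
  assumes mult_comm: "\<lbrakk> x \<in> carrier R; y \<in> carrier R \<rbrakk> \<Longrightarrow> x \<otimes> y = y \<otimes> x"

definition is_semiring :: "('a, 'm) ring_scheme \<Rightarrow> bool" where
  "is_semiring R \<longleftrightarrow> (\<exists>e. semiring (R\<lparr>one := e\<rparr>))"

definition is_field :: "('a, 'm) ring_scheme \<Rightarrow> bool" where
  "is_field R \<longleftrightarrow> (\<exists>e. field (R\<lparr>one := e\<rparr>))"

definition nonzero :: "('a, 'm) ring_scheme \<Rightarrow> bool" where
  "nonzero R \<longleftrightarrow> carrier R \<noteq> {\<zero>\<^bsub>R\<^esub>}"

definition hemiring_hom :: "('a, 'm) ring_scheme \<Rightarrow> ('b, 'n) ring_scheme \<Rightarrow> ('a \<Rightarrow> 'b) set" where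
  "hemiring_hom R S = {h. h \<in> carrier R \<rightarrow> carrier S \<and> h \<zero>\<^bsub>R\<^esub> = \<zero>\<^bsub>S\<^esub> \<and>
     (\<forall>x \<in> carrier R. \<forall>y \<in> carrier R.
        h (x \<oplus>\<^bsub>R\<^esub> y) = h x \<oplus>\<^bsub>S\<^esub> h y \<and> h (x \<otimes>\<^bsub>R\<^esub> y) = h x \<otimes>\<^bsub>S\<^esub> h y)}"

definition hemiring_epi :: "('a, 'm) ring_scheme \<Rightarrow> ('b, 'n) ring_scheme \<Rightarrow> ('a \<Rightarrow> 'b) set" where
  "hemiring_epi R S = {h \<in> hemiring_hom R S. h ` carrier R = carrier S}"

definition isomorphic :: "('a, 'm) ring_scheme \<Rightarrow> ('b, 'n) ring_scheme \<Rightarrow> bool" where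
  "isomorphic R S \<longleftrightarrow> (\<exists>h \<in> hemiring_hom R S. bij_betw h (carrier R) (carrier S))"

definition semiisomorphic :: "('a, 'm) ring_scheme \<Rightarrow> ('b, 'n) ring_scheme \<Rightarrow> bool" where
  "semiisomorphic R S \<longleftrightarrow>
     (\<exists>h \<in> hemiring_epi R S. {a \<in> carrier R. h a = \<zero>\<^bsub>S\<^esub>} = {\<zero>\<^bsub>R\<^esub>})"

definition hemiring_ideal :: "('a, 'm) ring_scheme \<Rightarrow> 'a set \<Rightarrow> bool" where
  "hemiring_ideal R I \<longleftrightarrow> I \<subseteq> carrier R \<and> \<zero>\<^bsub>R\<^esub> \<in> I \<and>
     (\<forall>x \<in> I. \<forall>y \<in> I. x \<oplus>\<^bsub>R\<^esub> y \<in> I) \<and>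
     (\<forall>x \<in> I. \<forall>r \<in> carrier R. r \<otimes>\<^bsub>R\<^esub> x \<in> I \<and> x \<otimes>\<^bsub>R\<^esub> r \<in> I)"

definition subhemiring :: "('a, 'm) ring_scheme \<Rightarrow> 'a set \<Rightarrow> bool" where
  "subhemiring R S \<longleftrightarrow> S \<subseteq> carrier R \<and> \<zero>\<^bsub>R\<^esub> \<in> S \<and>
     (\<forall>x \<in> S. \<forall>y \<in> S. x \<oplus>\<^bsub>R\<^esub> y \<in> S \<and> x \<otimes>\<^bsub>R\<^esub> y \<in> S)"


section \<open>Congruences and simplicity\<close>

definition congruence :: "('a, 'm) ring_scheme \<Rightarrow> 'a rel \<Rightarrow> bool" where
  "congruence R \<rho> \<longleftrightarrow> equiv (carrier R) \<rho> \<and>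
     (\<forall>(a, b) \<in> \<rho>. \<forall>(c, d) \<in> \<rho>.
        (a \<oplus>\<^bsub>R\<^esub> c, b \<oplus>\<^bsub>R\<^esub> d) \<in> \<rho> \<and> (a \<otimes>\<^bsub>R\<^esub> c, b \<otimes>\<^bsub>R\<^esub> d) \<in> \<rho>)"

definition hemiring_quotient :: "('a, 'm) ring_scheme \<Rightarrow> 'a rel \<Rightarrow> 'a set ring" where
  "hemiring_quotient R \<rho> =
     \<lparr> carrier = carrier R // \<rho>,
       mult = (\<lambda>X Y. \<Union>x \<in> X. \<Union>y \<in> Y. \<rho> `` {x \<otimes>\<^bsub>R\<^esub> y}),
       one = \<rho> `` {\<one>\<^bsub>R\<^esub>},
       zero = \<rho> `` {\<zero>\<^bsub>R\<^esub>},
       add = (\<lambda>X Y. \<Union>x \<in> X. \<Union>y \<in> Y. \<rho> `` {x \<oplus>\<^bsub>R\<^esub> y}) \<rparr>"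

definition ideal_simple :: "('a, 'm) ring_scheme \<Rightarrow> bool" where
  "ideal_simple R \<longleftrightarrow> (\<forall>I. hemiring_ideal R I \<longrightarrow> I = {\<zero>\<^bsub>R\<^esub>} \<or> I = carrier R)"

definition congruence_simple :: "('a, 'm) ring_scheme \<Rightarrow> bool" where
  "congruence_simple R \<longleftrightarrow>
     (\<forall>\<rho>. congruence R \<rho> \<longrightarrow> \<rho> = Id_on (carrier R) \<or> \<rho> = carrier R \<times> carrier R)"

definition simple :: "('a, 'm) ring_scheme \<Rightarrow> bool" where
  "simple R \<longleftrightarrow> ideal_simple R \<and> congruence_simple R"


section \<open>The two radicals\<close>

text \<open>
  Membership in the upper class of all hemirings without nonzero homomorphic image that is an
  ideal-simple semiring. The images are taken with carrier type \<^typ>\<open>'a set\<close>; by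
  \<open>no_ideal_simple_image_any_type\<close> below this is no restriction.
\<close>

definition no_ideal_simple_image :: "('a, 'm) ring_scheme \<Rightarrow> bool" where
  "no_ideal_simple_image A \<longleftrightarrow> hemiring A \<and>
     \<not> (\<exists>(T :: 'a set ring) h. hemiring T \<and> h \<in> hemiring_epi A T \<and>
          nonzero T \<and> is_semiring T \<and> ideal_simple T)"

definition brown_mccoy_radical :: "('a, 'm) ring_scheme \<Rightarrow> 'a set" where
  "brown_mccoy_radical R =
     \<Union>{I. hemiring_ideal R I \<and> no_ideal_simple_image (R\<lparr>carrier := I\<rparr>)}"

definition simple_semiring_congruences :: "('a, 'm) ring_scheme \<Rightarrow> 'a rel set" where
  "simple_semiring_congruences R =
     {\<rho>. congruence R \<rho> \<and> nonzero (hemiring_quotient R \<rho>) \<and>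
         is_semiring (hemiring_quotient R \<rho>) \<and> simple (hemiring_quotient R \<rho>)}"

definition zero_class :: "('a, 'm) ring_scheme \<Rightarrow> 'a rel \<Rightarrow> 'a set" where
  "zero_class R \<rho> = {r \<in> carrier R. (r, \<zero>\<^bsub>R\<^esub>) \<in> \<rho>}"

definition simple_congruence_radical :: "('a, 'm) ring_scheme \<Rightarrow> 'a set" where
  "simple_congruence_radical R =
     carrier R \<inter> (\<Inter>\<rho> \<in> simple_semiring_congruences R. zero_class R \<rho>)"


section \<open>Subdirect products\<close>

definition hemiring_product :: "'i set \<Rightarrow> ('i \<Rightarrow> 'b ring) \<Rightarrow> ('i \<Rightarrow> 'b) ring" where
  "hemiring_product I Q =
     \<lparr> carrier = (\<Pi>\<^sub>E i \<in> I. carrier (Q i)),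
       mult = (\<lambda>x y. \<lambda>i \<in> I. x i \<otimes>\<^bsub>Q i\<^esub> y i),
       one = (\<lambda>i \<in> I. \<one>\<^bsub>Q i\<^esub>),
       zero = (\<lambda>i \<in> I. \<zero>\<^bsub>Q i\<^esub>),
       add = (\<lambda>x y. \<lambda>i \<in> I. x i \<oplus>\<^bsub>Q i\<^esub> y i) \<rparr>"

definition subdirect_product :: "'i set \<Rightarrow> ('i \<Rightarrow> 'b ring) \<Rightarrow> ('i \<Rightarrow> 'b) ring \<Rightarrow> bool" where
  "subdirect_product I Q S \<longleftrightarrow>
     (\<exists>C. subhemiring (hemiring_product I Q) C \<and> S = (hemiring_product I Q)\<lparr>carrier := C\<rparr> \<and>
          (\<forall>i \<in> I. (\<lambda>x. x i) ` C = carrier (Q i)))"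

text \<open>
  \<open>R\<close> is semiisomorphic to a subdirect product of hemirings with property \<open>P\<close>. As types cannot
  be quantified existentially, the index type \<^typ>\<open>'i\<close> and the carrier type \<^typ>\<open>'b\<close> of the
  factors are parameters.
\<close>

definition semiiso_subdirect_product ::
    "'i itself \<Rightarrow> ('b ring \<Rightarrow> bool) \<Rightarrow> ('a, 'm) ring_scheme \<Rightarrow> bool" where
  "semiiso_subdirect_product TYPE('i) P R \<longleftrightarrow>
     (\<exists>(I :: 'i set) Q S. (\<forall>i \<in> I. P (Q i)) \<and> subdirect_product I Q S \<and> semiisomorphic R S)"

definition simple_comm_semiring :: "'b ring \<Rightarrow> bool" where
  "simple_comm_semiring Q \<longleftrightarrow> comm_hemiring Q \<and> is_semiring Q \<and> simple Q"

definition boolean_semifield :: "bool ring" where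
  "boolean_semifield =
     \<lparr> carrier = UNIV, mult = (\<and>), one = True, zero = False, add = (\<or>) \<rparr>"

definition field_or_boolean :: "'b ring \<Rightarrow> bool" where
  "field_or_boolean Q \<longleftrightarrow> is_field Q \<or> (hemiring Q \<and> isomorphic Q boolean_semifield)"


section \<open>Independence of the carrier type of homomorphic images\<close>

lemma hemiring_epi_image:
  assumes "hemiring T" and h: "h \<in> hemiring_epi T T'"
  shows "hemiring T'"
proof -
  interpret T: hemiring T by fact
  have im: "carrier T' = h ` carrier T" and z: "\<zero>\<^bsub>T'\<^esub> = h \<zero>\<^bsub>T\<^esub>"
    and a: "\<And>x y. x \<in> carrier T \<Longrightarrow> y \<in> carrier T \<Longrightarrow> h x \<oplus>\<^bsub>T'\<^esub> h y = h (x \<oplus>\<^bsub>T\<^esub> y)"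
    and m: "\<And>x y. x \<in> carrier T \<Longrightarrow> y \<in> carrier T \<Longrightarrow> h x \<otimes>\<^bsub>T'\<^esub> h y = h (x \<otimes>\<^bsub>T\<^esub> y)"
    using h by (auto simp: hemiring_epi_def hemiring_hom_def)
  show ?thesis
    by unfold_locales
      (auto simp: im z a m T.a_ac T.mult_closed T.mult_assoc T.mult_add_left T.mult_add_right
        T.mult_zero_left T.mult_zero_right)
qed

lemma is_semiring_epi_image:
  assumes "is_semiring T" and h: "h \<in> hemiring_epi T T'"
  shows "is_semiring T'"
proof -
  obtain e where "semiring (T\<lparr>one := e\<rparr>)" using assms(1) by (auto simp: is_semiring_def)
  then interpret T: semiring "T\<lparr>one := e\<rparr>" .
  have im: "carrier T' = h ` carrier T" and z: "\<zero>\<^bsub>T'\<^esub> = h \<zero>\<^bsub>T\<^esub>"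
    and a: "\<And>x y. x \<in> carrier T \<Longrightarrow> y \<in> carrier T \<Longrightarrow> h x \<oplus>\<^bsub>T'\<^esub> h y = h (x \<oplus>\<^bsub>T\<^esub> y)"
    and m: "\<And>x y. x \<in> carrier T \<Longrightarrow> y \<in> carrier T \<Longrightarrow> h x \<otimes>\<^bsub>T'\<^esub> h y = h (x \<otimes>\<^bsub>T\<^esub> y)"
    using h by (auto simp: hemiring_epi_def hemiring_hom_def)
  have "semiring (T'\<lparr>one := h e\<rparr>)"
    using T.a_ac T.m_assoc T.l_distr T.r_distr T.l_null T.r_null T.l_one T.r_one T.one_closed
      T.m_closed T.add.m_closed T.zero_closed T.l_zero T.r_zero
    by unfold_locales (auto simp: im z a m)
  then show ?thesis by (auto simp: is_semiring_def)
qed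

lemma ideal_simple_epi_image:
  assumes "hemiring T" "ideal_simple T" and h: "h \<in> hemiring_epi T T'"
  shows "ideal_simple T'"
  unfolding ideal_simple_def
proof (intro allI impI)
  interpret T: hemiring T by fact
  have im: "h ` carrier T = carrier T'" and z: "h \<zero>\<^bsub>T\<^esub> = \<zero>\<^bsub>T'\<^esub>"
    and a: "\<And>x y. x \<in> carrier T \<Longrightarrow> y \<in> carrier T \<Longrightarrow> h (x \<oplus>\<^bsub>T\<^esub> y) = h x \<oplus>\<^bsub>T'\<^esub> h y"
    and m: "\<And>x y. x \<in> carrier T \<Longrightarrow> y \<in> carrier T \<Longrightarrow> h (x \<otimes>\<^bsub>T\<^esub> y) = h x \<otimes>\<^bsub>T'\<^esub> h y"
    using h by (auto simp: hemiring_epi_def hemiring_hom_def)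
  fix J assume J: "hemiring_ideal T' J"
  define I where "I = {x \<in> carrier T. h x \<in> J}"
  have "h r \<in> carrier T'" if "r \<in> carrier T" for r
    using im that by blast
  then have "hemiring_ideal T I"
    using J by (simp add: hemiring_ideal_def I_def z a m T.mult_closed subset_iff)
  then have "I = {\<zero>\<^bsub>T\<^esub>} \<or> I = carrier T"
    using assms(2) by (auto simp: ideal_simple_def)
  moreover have "J = h ` I"
    using J im by (auto simp: hemiring_ideal_def I_def)
  ultimately show "J = {\<zero>\<^bsub>T'\<^esub>} \<or> J = carrier T'"
    using im z by auto
qed

lemma no_ideal_simple_image_any_type:
  fixes A :: "('a, 'm) ring_scheme" and T :: "('b, 'n) ring_scheme"
  assumes A: "no_ideal_simple_image A"
    and T: "hemiring T" "nonzero T" "is_semiring T" "ideal_simple T"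
    and h: "h \<in> hemiring_epi A T"
  shows False
proof -
  interpret T: hemiring T by fact
  define \<phi> where "\<phi> t = {x \<in> carrier A. h x = t}" for t
  define \<psi> where "\<psi> = inv_into (carrier T) \<phi>"
  define T' :: "'a set ring" where "T' =
    \<lparr> carrier = \<phi> ` carrier T, mult = (\<lambda>X Y. \<phi> (\<psi> X \<otimes>\<^bsub>T\<^esub> \<psi> Y)), one = {},
      zero = \<phi> \<zero>\<^bsub>T\<^esub>, add = (\<lambda>X Y. \<phi> (\<psi> X \<oplus>\<^bsub>T\<^esub> \<psi> Y)) \<rparr>"
  have im: "h ` carrier A = carrier T" using h by (simp add: hemiring_epi_def)
  have inj: "inj_on \<phi> (carrier T)"
  proof (rule inj_onI)
    fix s t assume "s \<in> carrier T" "t \<in> carrier T" "\<phi> s = \<phi> t"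
    moreover obtain x where "x \<in> carrier A" "h x = s" using im \<open>s \<in> carrier T\<close> by (metis imageE)
    ultimately show "s = t" by (auto simp: \<phi>_def)
  qed
  then have \<psi>: "\<psi> (\<phi> t) = t" if "t \<in> carrier T" for t
    using that by (simp add: \<psi>_def)
  have \<phi>: "\<phi> \<in> hemiring_epi T T'"
    by (auto simp: hemiring_epi_def hemiring_hom_def T'_def \<psi>)
  have "\<phi> \<circ> h \<in> hemiring_hom A T'"
    using h \<phi> by (auto simp: hemiring_epi_def hemiring_hom_def Pi_iff)
  moreover have "(\<phi> \<circ> h) ` carrier A = carrier T'"
    by (simp only: image_comp [symmetric] im) (simp add: T'_def)
  ultimately have "\<phi> \<circ> h \<in> hemiring_epi A T'"
    by (simp add: hemiring_epi_def)
  moreover have "nonzero T'"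
    unfolding nonzero_def
  proof
    assume "carrier T' = {\<zero>\<^bsub>T'\<^esub>}"
    then have "\<phi> ` carrier T = \<phi> ` {\<zero>\<^bsub>T\<^esub>}" by (simp add: T'_def)
    then have "carrier T = {\<zero>\<^bsub>T\<^esub>}"
      by (simp only: inj_on_image_eq_iff [OF inj] T.zero_closed insert_subset empty_subsetI order_refl)
    then show False using T(2) by (simp add: nonzero_def)
  qed
  ultimately show False
    using A T \<phi> hemiring_epi_image is_semiring_epi_image ideal_simple_epi_image
    unfolding no_ideal_simple_image_def by blast
qed

end

theory Submission
  imports Defs
begin

text \<open>
  For commutative \<open>R\<close> the two radicals coincide, whether or not they vanish. The reason is the
  structure of a nonzero commutative ideal-simple semiring \<open>T\<close>. It is a semifield, and the elements
  with an additive inverse form an ideal of it: either all of \<open>T\<close>, and \<open>T\<close> is a field, or \<open>0\<close>, and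
  sending all nonzero elements to \<open>1\<close> is a homomorphism onto the Boolean semifield
  (\<open>ideal_simple_field_or_boolean_image\<close>). Both targets are simple semirings, so \<open>T\<close> has a nonzero
  simple quotient in which only \<open>0\<close> becomes \<open>0\<close>; and if \<open>T\<close> is already simple it is itself one of
  the two (\<open>simple_field_or_boolean\<close>).

  An epimorphism from an ideal \<open>I\<close> of \<open>R\<close> onto a semiring extends to \<open>R\<close> (\<open>ideal_epi_extends\<close>). Hence if
  the congruence radical had a nonzero ideal-simple semiring as an image, \<open>R\<close> would have a simple
  quotient in which the radical does not vanish, which is absurd: the congruence radical lies in the
  Brown-McCoy radical. Conversely the Brown-McCoy radical vanishes in every ideal-simple semiring
  onto which \<open>R\<close> maps (\<open>brown_mccoy_radical_vanishes\<close>). This inclusion, applied to the factors of a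
  subdirect product, also shows that either representation forces the radical to be \<open>0\<close>. In the other
  direction the factors are the nonzero simple semiring quotients of \<open>R\<close>.
\<close>

section \<open>Homomorphisms and kernel congruences\<close>

lemma hemiring_homD:
  assumes "h \<in> hemiring_hom R S"
  shows "\<And>x. x \<in> carrier R \<Longrightarrow> h x \<in> carrier S" "h \<zero>\<^bsub>R\<^esub> = \<zero>\<^bsub>S\<^esub>"
    "\<And>x y. x \<in> carrier R \<Longrightarrow> y \<in> carrier R \<Longrightarrow> h (x \<oplus>\<^bsub>R\<^esub> y) = h x \<oplus>\<^bsub>S\<^esub> h y"
    "\<And>x y. x \<in> carrier R \<Longrightarrow> y \<in> carrier R \<Longrightarrow> h (x \<otimes>\<^bsub>R\<^esub> y) = h x \<otimes>\<^bsub>S\<^esub> h y"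
  using assms by (auto simp: hemiring_hom_def)

lemma hemiring_epiD:
  assumes "h \<in> hemiring_epi R S"
  shows "h \<in> hemiring_hom R S" "h ` carrier R = carrier S"
  using assms by (auto simp: hemiring_epi_def)

lemma hemiring_epi_comp:
  assumes "h \<in> hemiring_epi R S" "g \<in> hemiring_epi S T"
  shows "g \<circ> h \<in> hemiring_epi R T"
proof -
  have "(g \<circ> h) ` carrier R = carrier T"
    using assms by (simp only: image_comp [symmetric] hemiring_epi_def mem_Collect_eq)
  then show ?thesis
    using assms by (auto simp: hemiring_epi_def hemiring_hom_def Pi_iff)
qed

lemma comm_hemiring_epi_image:
  assumes "comm_hemiring T" and h: "h \<in> hemiring_epi T T'"
  shows "comm_hemiring T'"
proof -
  interpret T: comm_hemiring T by fact
  interpret T': hemiring T' by (rule hemiring_epi_image [OF T.hemiring_axioms h])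
  note hom = hemiring_homD [OF hemiring_epiD(1) [OF h]]
  show ?thesis
    by unfold_locales
      (auto simp: hemiring_epiD(2) [OF h, symmetric] hom(4) [symmetric] T.mult_comm)
qed

lemma congruence_simple_epi_image:
  assumes "hemiring T" "congruence_simple T" and h: "h \<in> hemiring_epi T T'"
  shows "congruence_simple T'"
  unfolding congruence_simple_def
proof (intro allI impI)
  interpret T: hemiring T by fact
  note hom = hemiring_homD [OF hemiring_epiD(1) [OF h]]
  note im = hemiring_epiD(2) [OF h, symmetric]
  fix \<rho> assume \<rho>: "congruence T' \<rho>"
  define \<sigma> where "\<sigma> = {(x, y). x \<in> carrier T \<and> y \<in> carrier T \<and> (h x, h y) \<in> \<rho>}"
  have eq: "equiv (carrier T') \<rho>" using \<rho> by (simp add: congruence_def)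
  have r: "\<And>x. x \<in> carrier T' \<Longrightarrow> (x, x) \<in> \<rho>"
    and s: "\<And>x y. (x, y) \<in> \<rho> \<Longrightarrow> (y, x) \<in> \<rho>"
    and t: "\<And>x y z. (x, y) \<in> \<rho> \<Longrightarrow> (y, z) \<in> \<rho> \<Longrightarrow> (x, z) \<in> \<rho>"
    and sub: "\<rho> \<subseteq> carrier T' \<times> carrier T'"
    using eq by (auto elim!: equivE dest: refl_onD symD transD)
  have "equiv (carrier T) \<sigma>"
    by (rule equivI) (auto simp: \<sigma>_def refl_on_def sym_def trans_def intro: r s t hom(1))
  then have "congruence T \<sigma>"
    using \<rho> by (auto simp: congruence_def \<sigma>_def hom T.mult_closed)
  then have "\<sigma> = Id_on (carrier T) \<or> \<sigma> = carrier T \<times> carrier T"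
    using assms(2) by (auto simp: congruence_simple_def)
  moreover have "\<rho> = map_prod h h ` \<sigma>"
    using sub by (force simp: \<sigma>_def im)
  ultimately show "\<rho> = Id_on (carrier T') \<or> \<rho> = carrier T' \<times> carrier T'"
    by (auto simp: im Id_on_def map_prod_surj_on)
qed

lemma hemiring_quotient_epi:
  assumes "congruence R \<rho>"
  shows "(\<lambda>r. \<rho> `` {r}) \<in> hemiring_epi R (hemiring_quotient R \<rho>)"
proof -
  have eq: "equiv (carrier R) \<rho>" using assms by (simp add: congruence_def)
  have union: "(\<Union>x\<in>\<rho> `` {a}. \<Union>y\<in>\<rho> `` {b}. \<rho> `` {f x y}) = \<rho> `` {f a b}"
    if ab: "a \<in> carrier R" "b \<in> carrier R"
      and f: "\<And>a b c d. (a, b) \<in> \<rho> \<Longrightarrow> (c, d) \<in> \<rho> \<Longrightarrow> (f a c, f b d) \<in> \<rho>" for f a b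
  proof -
    have "\<rho> `` {f x y} = \<rho> `` {f a b}" if "x \<in> \<rho> `` {a}" "y \<in> \<rho> `` {b}" for x y
      using that f equiv_class_eq [OF eq, of "f a b" "f x y"] by auto
    moreover have "a \<in> \<rho> `` {a}" "b \<in> \<rho> `` {b}"
      using ab equiv_class_self [OF eq] by auto
    ultimately show ?thesis by blast
  qed
  have compat: "(a \<oplus>\<^bsub>R\<^esub> c, b \<oplus>\<^bsub>R\<^esub> d) \<in> \<rho>" "(a \<otimes>\<^bsub>R\<^esub> c, b \<otimes>\<^bsub>R\<^esub> d) \<in> \<rho>"
    if "(a, b) \<in> \<rho>" "(c, d) \<in> \<rho>" for a b c d
    using assms that unfolding congruence_def by blast+
  have "(\<lambda>r. \<rho> `` {r}) ` carrier R = carrier R // \<rho>"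
    by (auto simp: quotient_def)
  then show ?thesis
    by (simp add: hemiring_epi_def hemiring_hom_def hemiring_quotient_def quotientI
        union [of _ _ "add R"] union [of _ _ "mult R"] compat)
qed

lemma hemiring_quotient_class_zero_iff:
  assumes "congruence R \<rho>" "hemiring R" "r \<in> carrier R"
  shows "\<rho> `` {r} = \<zero>\<^bsub>hemiring_quotient R \<rho>\<^esub> \<longleftrightarrow> (r, \<zero>\<^bsub>R\<^esub>) \<in> \<rho>"
proof -
  interpret hemiring R by fact
  show ?thesis
    using assms eq_equiv_class_iff [of "carrier R" \<rho> r "\<zero>\<^bsub>R\<^esub>"]
    by (simp add: congruence_def hemiring_quotient_def)
qed

definition kernel_congruence :: "('a, 'm) ring_scheme \<Rightarrow> ('a \<Rightarrow> 'b) \<Rightarrow> 'a rel" where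
  "kernel_congruence R f = {(x, y). x \<in> carrier R \<and> y \<in> carrier R \<and> f x = f y}"

lemma congruence_kernel_congruence:
  assumes "hemiring R" "f \<in> hemiring_hom R F"
  shows "congruence R (kernel_congruence R f)"
proof -
  interpret R: hemiring R by fact
  note hom = hemiring_homD [OF assms(2)]
  have "equiv (carrier R) (kernel_congruence R f)"
    by (rule equivI) (auto simp: kernel_congruence_def refl_on_def sym_def trans_def)
  then show ?thesis
    by (auto simp: congruence_def kernel_congruence_def hom R.mult_closed)
qed

text \<open>
  One direction of the first isomorphism theorem: \<open>F\<close> maps onto \<open>R\<close> modulo the kernel congruence,
  so that all properties inherited by homomorphic images pass from \<open>F\<close> to the quotient.
\<close>

lemma kernel_quotient_epi:
  assumes "hemiring R" and f: "f \<in> hemiring_epi R F"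
  shows "(\<lambda>t. {x \<in> carrier R. f x = t})
    \<in> hemiring_epi F (hemiring_quotient R (kernel_congruence R f))"
proof -
  interpret R: hemiring R by fact
  let ?\<rho> = "kernel_congruence R f" and ?\<phi> = "\<lambda>t. {x \<in> carrier R. f x = t}"
  note hom = hemiring_homD [OF hemiring_epiD(1) [OF f]]
  note im = hemiring_epiD(2) [OF f, symmetric]
  have q: "(\<lambda>r. ?\<rho> `` {r}) \<in> hemiring_epi R (hemiring_quotient R ?\<rho>)"
    by (rule hemiring_quotient_epi [OF congruence_kernel_congruence [OF assms(1) hemiring_epiD(1) [OF f]]])
  note qhom = hemiring_homD [OF hemiring_epiD(1) [OF q]]
  note qim = hemiring_epiD(2) [OF q]
  have cls: "?\<phi> (f r) = ?\<rho> `` {r}" if "r \<in> carrier R" for r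
    using that by (auto simp: kernel_congruence_def)
  have "?\<phi> ` carrier F = carrier (hemiring_quotient R ?\<rho>)"
    unfolding im qim [symmetric] image_image by (intro image_cong refl cls)
  moreover have "?\<phi> \<zero>\<^bsub>F\<^esub> = \<zero>\<^bsub>hemiring_quotient R ?\<rho>\<^esub>"
    using cls [of "\<zero>\<^bsub>R\<^esub>"] by (simp add: hom(2) qhom(2))
  moreover have "?\<phi> (s \<oplus>\<^bsub>F\<^esub> t) = ?\<phi> s \<oplus>\<^bsub>hemiring_quotient R ?\<rho>\<^esub> ?\<phi> t"
      "?\<phi> (s \<otimes>\<^bsub>F\<^esub> t) = ?\<phi> s \<otimes>\<^bsub>hemiring_quotient R ?\<rho>\<^esub> ?\<phi> t"
    if st: "s \<in> carrier F" "t \<in> carrier F" for s t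
  proof -
    obtain x y where xy: "x \<in> carrier R" "y \<in> carrier R" and s: "s = f x" and t: "t = f y"
      using st by (auto simp: im)
    have "x \<oplus>\<^bsub>R\<^esub> y \<in> carrier R" "x \<otimes>\<^bsub>R\<^esub> y \<in> carrier R"
      using xy R.mult_closed by auto
    then show "?\<phi> (s \<oplus>\<^bsub>F\<^esub> t) = ?\<phi> s \<oplus>\<^bsub>hemiring_quotient R ?\<rho>\<^esub> ?\<phi> t"
      "?\<phi> (s \<otimes>\<^bsub>F\<^esub> t) = ?\<phi> s \<otimes>\<^bsub>hemiring_quotient R ?\<rho>\<^esub> ?\<phi> t"
      unfolding s t using xy
      by (simp_all only: hom(3,4) [symmetric] cls qhom(3,4))
  qed
  ultimately show ?thesis
    unfolding hemiring_epi_def hemiring_hom_def by (simp add: Pi_iff) blast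
qed

text \<open>
  An epimorphism onto a nonzero simple semiring of any type is thus recorded by one of the
  congruences whose zero classes are intersected in the radical.
\<close>

lemma kernel_congruence_in_simple_semiring_congruences:
  assumes R: "hemiring R" and f: "f \<in> hemiring_epi R F"
    and F: "nonzero F" "is_semiring F" "simple F"
  shows "kernel_congruence R f \<in> simple_semiring_congruences R"
proof -
  interpret R: hemiring R by fact
  let ?\<rho> = "kernel_congruence R f"
  note hom = hemiring_homD [OF hemiring_epiD(1) [OF f]]
  have hF: "hemiring F" by (rule hemiring_epi_image [OF R f])
  note e = kernel_quotient_epi [OF R f]
  have \<rho>: "congruence R ?\<rho>"
    by (rule congruence_kernel_congruence [OF R hemiring_epiD(1) [OF f]])
  interpret F: hemiring F by (rule hF)
  obtain t where t: "t \<in> carrier F" "t \<noteq> \<zero>\<^bsub>F\<^esub>"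
    using F(1) F.zero_closed unfolding nonzero_def by blast
  then obtain r where r: "r \<in> carrier R" "f r \<noteq> \<zero>\<^bsub>F\<^esub>"
    using hemiring_epiD(2) [OF f] by (metis imageE)
  have "?\<rho> `` {r} \<noteq> \<zero>\<^bsub>hemiring_quotient R ?\<rho>\<^esub>"
    using r by (simp add: hemiring_quotient_class_zero_iff [OF \<rho> R r(1)]) (simp add: kernel_congruence_def hom)
  moreover have "?\<rho> `` {r} \<in> carrier (hemiring_quotient R ?\<rho>)"
    using r(1) by (simp add: hemiring_quotient_def quotientI)
  ultimately have "nonzero (hemiring_quotient R ?\<rho>)"
    by (auto simp: nonzero_def)
  then show ?thesis
    using \<rho> is_semiring_epi_image [OF F(2) e] ideal_simple_epi_image [OF hF _ e]
      congruence_simple_epi_image [OF hF _ e] F(3)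
    by (simp add: simple_semiring_congruences_def simple_def)
qed


section \<open>Commutative ideal-simple semirings\<close>

text \<open>An ideal-simple commutative semiring is a semifield, since \<open>Ta\<close> is an ideal containing \<open>a\<close>.\<close>

lemma ideal_simple_inverse:
  assumes "comm_hemiring T" "ideal_simple T"
    and e: "e \<in> carrier T" "\<And>x. x \<in> carrier T \<Longrightarrow> e \<otimes>\<^bsub>T\<^esub> x = x"
    and a: "a \<in> carrier T" "a \<noteq> \<zero>\<^bsub>T\<^esub>"
  obtains b where "b \<in> carrier T" "b \<otimes>\<^bsub>T\<^esub> a = e"
proof -
  interpret T: comm_hemiring T by fact
  let ?I = "(\<lambda>b. b \<otimes>\<^bsub>T\<^esub> a) ` carrier T"
  have "hemiring_ideal T ?I"
    unfolding hemiring_ideal_def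
  proof (intro conjI ballI)
    show "?I \<subseteq> carrier T" using a T.mult_closed by auto
    show "\<zero>\<^bsub>T\<^esub> \<in> ?I" using T.mult_zero_left [OF a(1)] T.zero_closed by (metis imageI)
    fix x assume "x \<in> ?I"
    then obtain b where b: "b \<in> carrier T" "x = b \<otimes>\<^bsub>T\<^esub> a" by auto
    { fix y assume "y \<in> ?I"
      then obtain c where "c \<in> carrier T" "y = c \<otimes>\<^bsub>T\<^esub> a" by auto
      then show "x \<oplus>\<^bsub>T\<^esub> y \<in> ?I"
        using a b T.mult_add_left [of b c a] by (intro image_eqI [of _ _ "b \<oplus>\<^bsub>T\<^esub> c"]) auto }
    fix r assume r: "r \<in> carrier T"
    show "r \<otimes>\<^bsub>T\<^esub> x \<in> ?I"
      using a b r by (intro image_eqI [of _ _ "r \<otimes>\<^bsub>T\<^esub> b"]) (auto simp: T.mult_assoc T.mult_closed)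
    then show "x \<otimes>\<^bsub>T\<^esub> r \<in> ?I"
      using a b r by (simp add: T.mult_comm [of r] T.mult_closed)
  qed
  then have "?I = {\<zero>\<^bsub>T\<^esub>} \<or> ?I = carrier T"
    using assms(2) by (auto simp: ideal_simple_def)
  moreover have "a \<in> ?I" using e a by force
  ultimately have "e \<in> ?I" using a e by auto
  then show thesis using that by auto
qed

lemma is_semiringE:
  assumes "is_semiring T"
  obtains e where "e \<in> carrier T" "\<And>x. x \<in> carrier T \<Longrightarrow> e \<otimes>\<^bsub>T\<^esub> x = x"
    "\<And>x. x \<in> carrier T \<Longrightarrow> x \<otimes>\<^bsub>T\<^esub> e = x"
proof -
  obtain e where "semiring (T\<lparr>one := e\<rparr>)" using assms by (auto simp: is_semiring_def)
  then interpret T: semiring "T\<lparr>one := e\<rparr>" .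
  show thesis using that [of e] T.one_closed T.l_one T.r_one by simp
qed

text \<open>
  The elements having an additive inverse form an ideal. If it is everything, the semifield is a
  field. If it is \<open>0\<close>, then nonzero elements are closed under addition, and under multiplication
  because they are invertible; hence "being nonzero" is a homomorphism onto the Boolean semifield.
\<close>

lemma ideal_simple_field_or_boolean_image:
  assumes "comm_hemiring T" "is_semiring T" "ideal_simple T" "nonzero T"
  shows "is_field T \<or> (\<lambda>x. x \<noteq> \<zero>\<^bsub>T\<^esub>) \<in> hemiring_epi T boolean_semifield"
proof -
  interpret T: comm_hemiring T by fact
  obtain e where e: "e \<in> carrier T" "\<And>x. x \<in> carrier T \<Longrightarrow> e \<otimes>\<^bsub>T\<^esub> x = x"
    "\<And>x. x \<in> carrier T \<Longrightarrow> x \<otimes>\<^bsub>T\<^esub> e = x"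
    using is_semiringE [OF assms(2)] by blast
  have e0: "e \<noteq> \<zero>\<^bsub>T\<^esub>"
    using assms(4) e T.mult_zero_left T.zero_closed unfolding nonzero_def by fastforce
  have inv: "\<exists>b \<in> carrier T. b \<otimes>\<^bsub>T\<^esub> a = e" if "a \<in> carrier T" "a \<noteq> \<zero>\<^bsub>T\<^esub>" for a
    using ideal_simple_inverse [OF assms(1,3) e(1,2) that] by blast
  define V where "V = {x \<in> carrier T. \<exists>y \<in> carrier T. x \<oplus>\<^bsub>T\<^esub> y = \<zero>\<^bsub>T\<^esub>}"
  have "hemiring_ideal T V"
    unfolding hemiring_ideal_def
  proof (intro conjI ballI)
    show "V \<subseteq> carrier T" "\<zero>\<^bsub>T\<^esub> \<in> V" by (auto simp: V_def)
    fix x assume "x \<in> V"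
    then obtain x' where x: "x \<in> carrier T" "x' \<in> carrier T" "x \<oplus>\<^bsub>T\<^esub> x' = \<zero>\<^bsub>T\<^esub>"
      by (auto simp: V_def)
    { fix y assume "y \<in> V"
      then obtain y' where y: "y \<in> carrier T" "y' \<in> carrier T" "y \<oplus>\<^bsub>T\<^esub> y' = \<zero>\<^bsub>T\<^esub>"
        by (auto simp: V_def)
      have "(x \<oplus>\<^bsub>T\<^esub> y) \<oplus>\<^bsub>T\<^esub> (x' \<oplus>\<^bsub>T\<^esub> y') = (x \<oplus>\<^bsub>T\<^esub> x') \<oplus>\<^bsub>T\<^esub> (y \<oplus>\<^bsub>T\<^esub> y')"
        using x(1,2) y(1,2) by (simp add: T.a_ac)
      then show "x \<oplus>\<^bsub>T\<^esub> y \<in> V"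
        using x y unfolding V_def by (auto intro!: bexI [of _ "x' \<oplus>\<^bsub>T\<^esub> y'"]) }
    fix r assume r: "r \<in> carrier T"
    have "r \<otimes>\<^bsub>T\<^esub> x \<oplus>\<^bsub>T\<^esub> r \<otimes>\<^bsub>T\<^esub> x' = \<zero>\<^bsub>T\<^esub>"
      using r x T.mult_add_right [of x x' r] T.mult_zero_right by simp
    then show "r \<otimes>\<^bsub>T\<^esub> x \<in> V"
      using r x T.mult_closed unfolding V_def by blast
    then show "x \<otimes>\<^bsub>T\<^esub> r \<in> V"
      using r x by (simp add: T.mult_comm)
  qed
  then consider "V = {\<zero>\<^bsub>T\<^esub>}" | "V = carrier T"
    using assms(3) unfolding ideal_simple_def by blast
  then show ?thesis
  proof cases
    case 1
    have "x = \<zero>\<^bsub>T\<^esub> \<and> y = \<zero>\<^bsub>T\<^esub>" if "x \<in> carrier T" "y \<in> carrier T" "x \<oplus>\<^bsub>T\<^esub> y = \<zero>\<^bsub>T\<^esub>" for x y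
    proof -
      have "x \<in> V" "y \<in> V" using that T.a_comm [of x y] unfolding V_def by auto
      then show ?thesis using 1 by simp
    qed
    then have add: "x \<oplus>\<^bsub>T\<^esub> y = \<zero>\<^bsub>T\<^esub> \<longleftrightarrow> x = \<zero>\<^bsub>T\<^esub> \<and> y = \<zero>\<^bsub>T\<^esub>"
      if "x \<in> carrier T" "y \<in> carrier T" for x y
      using that T.l_zero [OF T.zero_closed] by metis
    have "y = \<zero>\<^bsub>T\<^esub>" if xy: "x \<in> carrier T" "y \<in> carrier T" "x \<otimes>\<^bsub>T\<^esub> y = \<zero>\<^bsub>T\<^esub>" "x \<noteq> \<zero>\<^bsub>T\<^esub>" for x y
    proof -
      obtain b where b: "b \<in> carrier T" "b \<otimes>\<^bsub>T\<^esub> x = e" using inv xy by blast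
      then have "y = b \<otimes>\<^bsub>T\<^esub> (x \<otimes>\<^bsub>T\<^esub> y)" using xy(1,2) e T.mult_assoc [of b x y] by simp
      then show ?thesis using b xy T.mult_zero_right by simp
    qed
    then have mult: "x \<otimes>\<^bsub>T\<^esub> y = \<zero>\<^bsub>T\<^esub> \<longleftrightarrow> x = \<zero>\<^bsub>T\<^esub> \<or> y = \<zero>\<^bsub>T\<^esub>"
      if "x \<in> carrier T" "y \<in> carrier T" for x y
      using that T.mult_zero_left T.mult_zero_right by metis
    have "(\<lambda>x. x \<noteq> \<zero>\<^bsub>T\<^esub>) ` carrier T = UNIV"
    proof -
      have "{False, True} \<subseteq> (\<lambda>x. x \<noteq> \<zero>\<^bsub>T\<^esub>) ` carrier T"
        using e(1) e0 T.zero_closed by (auto simp: image_iff)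
      then show ?thesis using UNIV_bool by blast
    qed
    then show ?thesis
      by (simp add: hemiring_epi_def hemiring_hom_def boolean_semifield_def add mult)
  next
    case 2
    let ?F = "T\<lparr>one := e\<rparr>"
    have "abelian_group ?F"
      by (rule abelian_groupI)
        (use 2 T.a_comm in \<open>auto simp: T.a_ac V_def\<close>)
    moreover have "comm_monoid ?F"
      by (rule comm_monoidI) (auto simp: e T.mult_closed T.mult_assoc intro: T.mult_comm)
    ultimately have cr: "cring ?F"
      by (rule cringI) (simp add: T.mult_add_left)
    have "Units ?F = carrier ?F - {\<zero>\<^bsub>?F\<^esub>}"
    proof
      show "Units ?F \<subseteq> carrier ?F - {\<zero>\<^bsub>?F\<^esub>}"
        using e0 T.mult_zero_left by (auto simp: Units_def)
      show "carrier ?F - {\<zero>\<^bsub>?F\<^esub>} \<subseteq> Units ?F"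
      proof
        fix x assume "x \<in> carrier ?F - {\<zero>\<^bsub>?F\<^esub>}"
        then have x: "x \<in> carrier T" and "x \<noteq> \<zero>\<^bsub>T\<^esub>" by auto
        then obtain y where y: "y \<in> carrier T" "y \<otimes>\<^bsub>T\<^esub> x = e" using inv by blast
        then have "x \<otimes>\<^bsub>T\<^esub> y = e" using x T.mult_comm by metis
        then show "x \<in> Units ?F" using x y unfolding Units_def by auto
      qed
    qed
    then have "field ?F" by (rule cring.cring_fieldI [OF cr])
    then show ?thesis by (auto simp: is_field_def)
  qed
qed

text \<open>
  Congruence-simplicity leaves no room for a proper quotient, so when \<open>T\<close> is not a field its map
  onto the Boolean semifield is injective.
\<close>

lemma simple_field_or_boolean:
  assumes "simple_comm_semiring T" "nonzero T"
  shows "field_or_boolean T"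
proof (cases "is_field T")
  case False
  interpret T: comm_hemiring T using assms(1) by (simp add: simple_comm_semiring_def)
  let ?g = "\<lambda>x. x \<noteq> \<zero>\<^bsub>T\<^esub>"
  have g: "?g \<in> hemiring_epi T boolean_semifield"
    using ideal_simple_field_or_boolean_image [of T] assms False
    by (auto simp: simple_comm_semiring_def simple_def)
  have "congruence T (kernel_congruence T ?g)"
    by (rule congruence_kernel_congruence [OF T.hemiring_axioms hemiring_epiD(1) [OF g]])
  then have "kernel_congruence T ?g = Id_on (carrier T)
      \<or> kernel_congruence T ?g = carrier T \<times> carrier T"
    using assms(1) by (simp add: simple_comm_semiring_def simple_def congruence_simple_def)
  moreover obtain a where "a \<in> carrier T" "a \<noteq> \<zero>\<^bsub>T\<^esub>"
    using assms(2) T.zero_closed unfolding nonzero_def by blast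
  then have "(a, \<zero>\<^bsub>T\<^esub>) \<in> carrier T \<times> carrier T - kernel_congruence T ?g"
    by (simp add: kernel_congruence_def)
  ultimately have "kernel_congruence T ?g = Id_on (carrier T)" by blast
  then have "inj_on ?g (carrier T)"
    unfolding inj_on_def kernel_congruence_def by blast
  then have "isomorphic T boolean_semifield"
    using hemiring_epiD [OF g] unfolding isomorphic_def bij_betw_def by blast
  then show ?thesis by (simp add: field_or_boolean_def T.hemiring_axioms)
qed (simp add: field_or_boolean_def)

lemma field_simple_semiring:
  assumes "is_field F"
  shows "comm_hemiring F" "is_semiring F" "simple F" "nonzero F"
proof -
  obtain e where "field (F\<lparr>one := e\<rparr>)" using assms by (auto simp: is_field_def)
  then interpret F: field "F\<lparr>one := e\<rparr>" .
  show "is_semiring F" using F.semiring_axioms by (auto simp: is_semiring_def)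
  show c: "comm_hemiring F"
    using F.a_ac F.m_assoc F.m_comm F.l_distr F.r_distr F.l_null F.r_null
      F.m_closed F.add.m_closed F.zero_closed F.l_zero F.r_zero
    by unfold_locales auto
  interpret C: comm_hemiring F by (rule c)
  have one: "e \<in> carrier F" "e \<noteq> \<zero>\<^bsub>F\<^esub>" "\<And>x. x \<in> carrier F \<Longrightarrow> x \<otimes>\<^bsub>F\<^esub> e = x"
    using F.one_closed F.one_not_zero F.r_one by auto
  show "nonzero F" using one by (auto simp: nonzero_def)
  have inv: "\<exists>y \<in> carrier F. y \<otimes>\<^bsub>F\<^esub> x = e" if "x \<in> carrier F" "x \<noteq> \<zero>\<^bsub>F\<^esub>" for x
    using F.field_Units that by (auto simp: Units_def)
  have "ideal_simple F"
    unfolding ideal_simple_def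
  proof (intro allI impI)
    fix I assume I: "hemiring_ideal F I"
    show "I = {\<zero>\<^bsub>F\<^esub>} \<or> I = carrier F"
    proof (cases "I = {\<zero>\<^bsub>F\<^esub>}")
      case False
      then obtain x where x: "x \<in> I" "x \<in> carrier F" "x \<noteq> \<zero>\<^bsub>F\<^esub>"
        using I unfolding hemiring_ideal_def by blast
      then obtain y where "y \<in> carrier F" "y \<otimes>\<^bsub>F\<^esub> x = e" using inv by blast
      then have "e \<in> I" using I x unfolding hemiring_ideal_def by metis
      then have "carrier F \<subseteq> I"
        using I one(3) unfolding hemiring_ideal_def by (metis subsetI)
      then show ?thesis using I unfolding hemiring_ideal_def by blast
    qed simp
  qed
  moreover have "congruence_simple F"
    unfolding congruence_simple_def
  proof (intro allI impI)
    fix \<rho> assume \<rho>: "congruence F \<rho>"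
    then have eq: "equiv (carrier F) \<rho>" by (simp add: congruence_def)
    have r: "\<And>x. x \<in> carrier F \<Longrightarrow> (x, x) \<in> \<rho>"
      and s: "\<And>x y. (x, y) \<in> \<rho> \<Longrightarrow> (y, x) \<in> \<rho>"
      and t: "\<And>x y z. (x, y) \<in> \<rho> \<Longrightarrow> (y, z) \<in> \<rho> \<Longrightarrow> (x, z) \<in> \<rho>"
      and sub: "\<rho> \<subseteq> carrier F \<times> carrier F"
      using eq by (auto elim!: equivE dest: refl_onD symD transD)
    have add: "(a \<oplus>\<^bsub>F\<^esub> c, b \<oplus>\<^bsub>F\<^esub> d) \<in> \<rho>" and mult: "(a \<otimes>\<^bsub>F\<^esub> c, b \<otimes>\<^bsub>F\<^esub> d) \<in> \<rho>"
      if "(a, b) \<in> \<rho>" "(c, d) \<in> \<rho>" for a b c d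
      using \<rho> that unfolding congruence_def by blast+
    show "\<rho> = Id_on (carrier F) \<or> \<rho> = carrier F \<times> carrier F"
    proof (cases "\<rho> \<subseteq> Id")
      case True
      then show ?thesis using r sub by (auto simp: Id_on_def)
    next
      case False
      then obtain a b where ab: "(a, b) \<in> \<rho>" "a \<noteq> b" by auto
      then have c: "a \<in> carrier F" "b \<in> carrier F" using sub by auto
      obtain b' where b': "b' \<in> carrier F" "b \<oplus>\<^bsub>F\<^esub> b' = \<zero>\<^bsub>F\<^esub>"
        using F.r_neg [of b] F.a_inv_closed [of b] c by auto
      let ?d = "a \<oplus>\<^bsub>F\<^esub> b'"
      have d: "(?d, \<zero>\<^bsub>F\<^esub>) \<in> \<rho>" using add [OF ab(1) r [OF b'(1)]] b' by simp
      have "?d \<noteq> \<zero>\<^bsub>F\<^esub>"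
      proof
        assume "?d = \<zero>\<^bsub>F\<^esub>"
        then have "a \<oplus>\<^bsub>F\<^esub> b' = b \<oplus>\<^bsub>F\<^esub> b'" using b' by simp
        then show False using ab c b' F.add.right_cancel [of b' a b] by simp
      qed
      then obtain y where y: "y \<in> carrier F" "y \<otimes>\<^bsub>F\<^esub> ?d = e"
        using inv [of ?d] c b' by auto
      have "(e, \<zero>\<^bsub>F\<^esub>) \<in> \<rho>" using mult [OF r [OF y(1)] d] y C.mult_zero_right by simp
      then have "(x, \<zero>\<^bsub>F\<^esub>) \<in> \<rho>" if "x \<in> carrier F" for x
        using mult [OF r [OF that]] that one(3) C.mult_zero_right by fastforce
      then show ?thesis using s t sub by blast
    qed
  qed
  ultimately show "simple F" by (simp add: simple_def)
qed

lemma boolean_semifield_simple_semiring: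
  "comm_hemiring boolean_semifield" "is_semiring boolean_semifield" "simple boolean_semifield"
  "nonzero boolean_semifield"
proof -
  have "boolean_semifield\<lparr>one := True\<rparr> = boolean_semifield"
    by (simp add: boolean_semifield_def)
  moreover have "semiring boolean_semifield"
    by unfold_locales (auto simp: boolean_semifield_def)
  ultimately show "is_semiring boolean_semifield" unfolding is_semiring_def by metis
  show "comm_hemiring boolean_semifield"
    by unfold_locales (auto simp: boolean_semifield_def)
  show "nonzero boolean_semifield" by (auto simp: boolean_semifield_def nonzero_def)
  have "ideal_simple boolean_semifield"
    by (auto simp: ideal_simple_def hemiring_ideal_def boolean_semifield_def)
  moreover have "congruence_simple boolean_semifield"
    unfolding congruence_simple_def
  proof (intro allI impI)
    fix \<rho> assume \<rho>: "congruence boolean_semifield \<rho>"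
    then have "equiv UNIV \<rho>" by (simp add: congruence_def boolean_semifield_def)
    then have r: "\<And>x. (x, x) \<in> \<rho>" and s: "\<And>x y. (x, y) \<in> \<rho> \<Longrightarrow> (y, x) \<in> \<rho>"
      by (auto elim!: equivE dest: refl_onD symD)
    have "\<rho> = Id \<or> \<rho> = UNIV"
    proof (cases "(False, True) \<in> \<rho>")
      case True
      then have "(x, y) \<in> \<rho>" for x y using r s by (cases x; cases y) auto
      then show ?thesis by auto
    next
      case False
      then have "(x, y) \<in> \<rho> \<Longrightarrow> x = y" for x y using s by (cases x; cases y) auto
      then show ?thesis using r by auto
    qed
    then show "\<rho> = Id_on (carrier boolean_semifield)
        \<or> \<rho> = carrier boolean_semifield \<times> carrier boolean_semifield"
      by (auto simp: boolean_semifield_def Id_on_def)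
  qed
  ultimately show "simple boolean_semifield" by (simp add: simple_def)
qed

lemma field_or_boolean_ideal_simple_semiring:
  assumes "field_or_boolean Q"
  shows "hemiring Q" "is_semiring Q" "ideal_simple Q"
proof -
  have "hemiring Q \<and> is_semiring Q \<and> ideal_simple Q"
  proof (cases "is_field Q")
    case True
    then show ?thesis using field_simple_semiring [OF True]
      by (simp add: simple_def comm_hemiring_def)
  next
    case False
    then obtain h where Q: "hemiring Q" and h: "h \<in> hemiring_hom Q boolean_semifield"
      and bij: "bij_betw h (carrier Q) (carrier boolean_semifield)"
      using assms by (auto simp: field_or_boolean_def isomorphic_def)
    interpret Q: hemiring Q by fact
    note hom = hemiring_homD [OF h]
    let ?k = "inv_into (carrier Q) h"
    have hk: "\<And>b. b \<in> carrier boolean_semifield \<Longrightarrow> ?k b \<in> carrier Q \<and> h (?k b) = b"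
      using bij by (metis bij_betw_imp_surj_on inv_into_into f_inv_into_f)
    have kh: "\<And>x. x \<in> carrier Q \<Longrightarrow> ?k (h x) = x"
      using bij by (simp add: bij_betw_inv_into_left)
    have "?k (a \<oplus>\<^bsub>boolean_semifield\<^esub> b) = ?k a \<oplus>\<^bsub>Q\<^esub> ?k b"
         "?k (a \<otimes>\<^bsub>boolean_semifield\<^esub> b) = ?k a \<otimes>\<^bsub>Q\<^esub> ?k b"
      if "a \<in> carrier boolean_semifield" "b \<in> carrier boolean_semifield" for a b
      using hk [OF that(1)] hk [OF that(2)] kh [of "?k a \<oplus>\<^bsub>Q\<^esub> ?k b"] kh [of "?k a \<otimes>\<^bsub>Q\<^esub> ?k b"]
      by (simp_all add: hom Q.mult_closed)
    moreover have "?k \<zero>\<^bsub>boolean_semifield\<^esub> = \<zero>\<^bsub>Q\<^esub>"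
      using kh [of "\<zero>\<^bsub>Q\<^esub>"] by (simp add: hom)
    moreover have "?k ` carrier boolean_semifield = carrier Q"
      by (rule bij_betw_imp_surj_on [OF bij_betw_inv_into [OF bij]])
    ultimately have k: "?k \<in> hemiring_epi boolean_semifield Q"
      using hk by (auto simp: hemiring_epi_def hemiring_hom_def)
    have "hemiring boolean_semifield"
      using boolean_semifield_simple_semiring(1) by (simp add: comm_hemiring_def)
    then show ?thesis
      using Q is_semiring_epi_image [OF _ k] ideal_simple_epi_image [OF _ _ k]
        boolean_semifield_simple_semiring by (simp add: simple_def)
  qed
  then show "hemiring Q" "is_semiring Q" "ideal_simple Q" by auto
qed


section \<open>The two radicals\<close>

lemma hemiring_ideal_hemiring:
  assumes "hemiring R" "hemiring_ideal R I"
  shows "hemiring (R\<lparr>carrier := I\<rparr>)"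
proof -
  interpret R: hemiring R by fact
  have I: "\<And>x. x \<in> I \<Longrightarrow> x \<in> carrier R" "\<zero>\<^bsub>R\<^esub> \<in> I"
    "\<And>x y. x \<in> I \<Longrightarrow> y \<in> I \<Longrightarrow> x \<oplus>\<^bsub>R\<^esub> y \<in> I"
    "\<And>x y. x \<in> I \<Longrightarrow> y \<in> I \<Longrightarrow> x \<otimes>\<^bsub>R\<^esub> y \<in> I"
    using assms(2) by (auto simp: hemiring_ideal_def)
  show ?thesis
    by unfold_locales
      (auto simp: I R.a_ac R.mult_assoc R.mult_add_left R.mult_add_right
        R.mult_zero_left R.mult_zero_right)
qed

text \<open>
  The image of an ideal \<open>J\<close> from the upper class under an epimorphism is an ideal. In an
  ideal-simple semiring it is \<open>0\<close> or everything, and the latter would make that semiring, when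
  nonzero, a forbidden image of \<open>J\<close>.
\<close>

lemma brown_mccoy_radical_vanishes:
  assumes "hemiring R" and f: "f \<in> hemiring_epi R Q"
    and Q: "is_semiring Q" "ideal_simple Q"
    and x: "x \<in> brown_mccoy_radical R"
  shows "f x = \<zero>\<^bsub>Q\<^esub>"
proof -
  interpret R: hemiring R by fact
  have hQ: "hemiring Q" by (rule hemiring_epi_image [OF assms(1) f])
  note hom = hemiring_homD [OF hemiring_epiD(1) [OF f]]
  note im = hemiring_epiD(2) [OF f, symmetric]
  obtain J where J: "hemiring_ideal R J" "no_ideal_simple_image (R\<lparr>carrier := J\<rparr>)" "x \<in> J"
    using x by (auto simp: brown_mccoy_radical_def)
  have JR: "J \<subseteq> carrier R" using J by (simp add: hemiring_ideal_def)
  have "hemiring_ideal Q (f ` J)"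
    unfolding hemiring_ideal_def
  proof (intro conjI ballI)
    show "f ` J \<subseteq> carrier Q" using JR hom(1) by auto
    show "\<zero>\<^bsub>Q\<^esub> \<in> f ` J" using J hom(2) unfolding hemiring_ideal_def by (metis imageI)
    fix s assume "s \<in> f ` J"
    then obtain a where a: "a \<in> J" "s = f a" by auto
    { fix t assume "t \<in> f ` J"
      then obtain b where "b \<in> J" "t = f b" by auto
      then show "s \<oplus>\<^bsub>Q\<^esub> t \<in> f ` J"
        using a J JR hom(3) [of a b] unfolding hemiring_ideal_def by (metis imageI subsetD) }
    fix t assume "t \<in> carrier Q"
    then obtain r where "r \<in> carrier R" "t = f r" by (auto simp: im)
    then show "t \<otimes>\<^bsub>Q\<^esub> s \<in> f ` J" "s \<otimes>\<^bsub>Q\<^esub> t \<in> f ` J"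
      using a J JR hom(4) [of r a] hom(4) [of a r] unfolding hemiring_ideal_def
      by (metis imageI subsetD)+
  qed
  then consider "f ` J = {\<zero>\<^bsub>Q\<^esub>}" | "f ` J = carrier Q"
    using Q(2) unfolding ideal_simple_def by blast
  then show ?thesis
  proof cases
    case 1
    then show ?thesis using J(3) by auto
  next
    case 2
    then have "f \<in> hemiring_epi (R\<lparr>carrier := J\<rparr>) Q"
      using JR hom by (auto simp: hemiring_epi_def hemiring_hom_def subset_iff)
    then have "\<not> nonzero Q"
      using no_ideal_simple_image_any_type [OF J(2) hQ _ Q] by blast
    then show ?thesis using 2 J(3) by (auto simp: nonzero_def)
  qed
qed

lemma zero_in_brown_mccoy_radical:
  assumes "hemiring R"
  shows "\<zero>\<^bsub>R\<^esub> \<in> brown_mccoy_radical R"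
proof -
  interpret R: hemiring R by fact
  have I: "hemiring_ideal R {\<zero>\<^bsub>R\<^esub>}"
    by (auto simp: hemiring_ideal_def R.mult_zero_left R.mult_zero_right)
  moreover have "no_ideal_simple_image (R\<lparr>carrier := {\<zero>\<^bsub>R\<^esub>}\<rparr>)"
    using hemiring_ideal_hemiring [OF assms I]
    by (simp add: no_ideal_simple_image_def hemiring_epi_def hemiring_hom_def nonzero_def) metis
  ultimately show ?thesis unfolding brown_mccoy_radical_def by blast
qed

text \<open>
  If \<open>e \<in> I\<close> is mapped to the identity of \<open>T\<close>, then \<open>r \<mapsto> h (r e)\<close> extends \<open>h\<close> to all of \<open>R\<close>;
  it is multiplicative because \<open>h (r s e) h (e) = h (r s e\<^sup>2) = h (r e) h (s e)\<close>.
\<close>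

lemma ideal_epi_extends:
  assumes "comm_hemiring R" and I: "hemiring_ideal R I"
    and h: "h \<in> hemiring_epi (R\<lparr>carrier := I\<rparr>) T" and T: "is_semiring T"
  obtains f where "f \<in> hemiring_epi R T" "\<And>x. x \<in> I \<Longrightarrow> f x = h x"
proof -
  interpret R: comm_hemiring R by fact
  have hi: "\<And>x. x \<in> I \<Longrightarrow> h x \<in> carrier T" "h \<zero>\<^bsub>R\<^esub> = \<zero>\<^bsub>T\<^esub>"
    "\<And>x y. x \<in> I \<Longrightarrow> y \<in> I \<Longrightarrow> h (x \<oplus>\<^bsub>R\<^esub> y) = h x \<oplus>\<^bsub>T\<^esub> h y"
    "\<And>x y. x \<in> I \<Longrightarrow> y \<in> I \<Longrightarrow> h (x \<otimes>\<^bsub>R\<^esub> y) = h x \<otimes>\<^bsub>T\<^esub> h y"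
    and im: "h ` I = carrier T"
    using hemiring_homD [OF hemiring_epiD(1) [OF h]] hemiring_epiD(2) [OF h] by auto
  obtain u where u: "u \<in> carrier T" "\<And>x. x \<in> carrier T \<Longrightarrow> u \<otimes>\<^bsub>T\<^esub> x = x"
    "\<And>x. x \<in> carrier T \<Longrightarrow> x \<otimes>\<^bsub>T\<^esub> u = x"
    using is_semiringE [OF T] by blast
  then obtain e where e: "e \<in> I" "h e = u" using im by (metis imageE)
  have IR: "I \<subseteq> carrier R" and eR: "e \<in> carrier R"
    using I e by (auto simp: hemiring_ideal_def)
  have re: "r \<otimes>\<^bsub>R\<^esub> e \<in> I" if "r \<in> carrier R" for r
    using that I e by (auto simp: hemiring_ideal_def)
  define f where "f r = h (r \<otimes>\<^bsub>R\<^esub> e)" for r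
  have ext: "f x = h x" if "x \<in> I" for x
    using that e u(3) hi by (simp add: f_def)
  have "f (r \<oplus>\<^bsub>R\<^esub> s) = f r \<oplus>\<^bsub>T\<^esub> f s" if "r \<in> carrier R" "s \<in> carrier R" for r s
    using that eR re hi(3) by (simp add: f_def R.mult_add_left)
  moreover have "f (r \<otimes>\<^bsub>R\<^esub> s) = f r \<otimes>\<^bsub>T\<^esub> f s" if rs: "r \<in> carrier R" "s \<in> carrier R" for r s
  proof -
    have cl: "r \<otimes>\<^bsub>R\<^esub> s \<in> carrier R" using rs R.mult_closed by auto
    have "(r \<otimes>\<^bsub>R\<^esub> s \<otimes>\<^bsub>R\<^esub> e) \<otimes>\<^bsub>R\<^esub> e = r \<otimes>\<^bsub>R\<^esub> (e \<otimes>\<^bsub>R\<^esub> (s \<otimes>\<^bsub>R\<^esub> e))"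
      using rs eR cl by (simp add: R.mult_assoc R.mult_closed R.mult_comm [of e "s \<otimes>\<^bsub>R\<^esub> e"])
    also have "\<dots> = (r \<otimes>\<^bsub>R\<^esub> e) \<otimes>\<^bsub>R\<^esub> (s \<otimes>\<^bsub>R\<^esub> e)"
      using rs eR by (simp add: R.mult_assoc R.mult_closed)
    finally have "h (r \<otimes>\<^bsub>R\<^esub> s \<otimes>\<^bsub>R\<^esub> e) \<otimes>\<^bsub>T\<^esub> h e = h (r \<otimes>\<^bsub>R\<^esub> e) \<otimes>\<^bsub>T\<^esub> h (s \<otimes>\<^bsub>R\<^esub> e)"
      using hi(4) [of "r \<otimes>\<^bsub>R\<^esub> s \<otimes>\<^bsub>R\<^esub> e" e] hi(4) [of "r \<otimes>\<^bsub>R\<^esub> e" "s \<otimes>\<^bsub>R\<^esub> e"] re rs cl e(1) by simp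
    then show ?thesis
      using e(2) u(3) hi(1) [OF re [OF cl]] by (simp add: f_def)
  qed
  moreover have "f \<zero>\<^bsub>R\<^esub> = \<zero>\<^bsub>T\<^esub>" using eR hi(2) by (simp add: f_def R.mult_zero_left)
  moreover have fc: "f \<in> carrier R \<rightarrow> carrier T" using re hi(1) by (auto simp: f_def)
  moreover have "f ` carrier R = carrier T"
  proof
    show "f ` carrier R \<subseteq> carrier T" using fc by auto
    have "carrier T = f ` I" using im ext by simp
    then show "carrier T \<subseteq> f ` carrier R" using IR by auto
  qed
  ultimately have "f \<in> hemiring_epi R T"
    by (simp add: hemiring_epi_def hemiring_hom_def)
  then show thesis using that ext by blast
qed

lemma simple_congruence_radical_ideal:
  assumes "hemiring R"
  shows "hemiring_ideal R (simple_congruence_radical R)"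
proof -
  interpret R: hemiring R by fact
  have "hemiring_ideal R (zero_class R \<rho>)" if "congruence R \<rho>" for \<rho>
  proof -
    have r: "\<And>x. x \<in> carrier R \<Longrightarrow> (x, x) \<in> \<rho>"
      using that by (auto simp: congruence_def elim!: equivE dest: refl_onD)
    have add: "(a \<oplus>\<^bsub>R\<^esub> c, b \<oplus>\<^bsub>R\<^esub> d) \<in> \<rho>" and mult: "(a \<otimes>\<^bsub>R\<^esub> c, b \<otimes>\<^bsub>R\<^esub> d) \<in> \<rho>"
      if "(a, b) \<in> \<rho>" "(c, d) \<in> \<rho>" for a b c d
      using \<open>congruence R \<rho>\<close> that unfolding congruence_def by blast+
    show ?thesis
      using r add [of _ "\<zero>\<^bsub>R\<^esub>" _ "\<zero>\<^bsub>R\<^esub>"] mult [OF _ r, of _ "\<zero>\<^bsub>R\<^esub>"] mult [OF r, of _ _ "\<zero>\<^bsub>R\<^esub>"]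
      by (auto simp: hemiring_ideal_def zero_class_def R.mult_closed R.mult_zero_left
          R.mult_zero_right)
  qed
  then have "\<And>\<rho>. \<rho> \<in> simple_semiring_congruences R \<Longrightarrow> hemiring_ideal R (zero_class R \<rho>)"
    by (simp add: simple_semiring_congruences_def)
  then show ?thesis
    unfolding simple_congruence_radical_def hemiring_ideal_def
    by (auto simp: R.mult_closed)
qed

lemma simple_congruence_radical_vanishes:
  assumes "hemiring R" and g: "g \<in> hemiring_epi R F"
    and F: "nonzero F" "is_semiring F" "simple F"
    and x: "x \<in> simple_congruence_radical R"
  shows "g x = \<zero>\<^bsub>F\<^esub>"
proof -
  have "(x, \<zero>\<^bsub>R\<^esub>) \<in> kernel_congruence R g"
    using x kernel_congruence_in_simple_semiring_congruences [OF assms(1) g F]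
    by (auto simp: simple_congruence_radical_def zero_class_def)
  then show ?thesis
    using hemiring_homD(2) [OF hemiring_epiD(1) [OF g]] by (simp add: kernel_congruence_def)
qed

text \<open>
  For \<open>\<supseteq>\<close>, the congruence radical itself has no ideal-simple semiring \<open>T\<close> as a nonzero image:
  such a map would extend to \<open>R\<close>, then continue to a simple semiring, namely \<open>T\<close> if it is a field
  and the Boolean semifield otherwise, without vanishing on the preimage of a nonzero element.
\<close>

lemma brown_mccoy_radical_eq_simple_congruence_radical:
  assumes "comm_hemiring R"
  shows "brown_mccoy_radical R = simple_congruence_radical R"
proof
  interpret R: comm_hemiring R by fact
  show "brown_mccoy_radical R \<subseteq> simple_congruence_radical R"
  proof
    fix x assume x: "x \<in> brown_mccoy_radical R"
    then have xR: "x \<in> carrier R"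
      by (auto simp: brown_mccoy_radical_def hemiring_ideal_def)
    have "x \<in> zero_class R \<rho>" if "\<rho> \<in> simple_semiring_congruences R" for \<rho>
    proof -
      have \<rho>: "congruence R \<rho>" "is_semiring (hemiring_quotient R \<rho>)"
        "ideal_simple (hemiring_quotient R \<rho>)"
        using that by (auto simp: simple_semiring_congruences_def simple_def)
      have "\<rho> `` {x} = \<zero>\<^bsub>hemiring_quotient R \<rho>\<^esub>"
        by (rule brown_mccoy_radical_vanishes
            [OF R.hemiring_axioms hemiring_quotient_epi [OF \<rho>(1)] \<rho>(2,3) x])
      then show ?thesis
        using hemiring_quotient_class_zero_iff [OF \<rho>(1) R.hemiring_axioms xR] xR
        by (simp add: zero_class_def)
    qed
    then show "x \<in> simple_congruence_radical R"
      using xR by (simp add: simple_congruence_radical_def)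
  qed
  let ?I = "simple_congruence_radical R"
  have I: "hemiring_ideal R ?I" by (rule simple_congruence_radical_ideal [OF R.hemiring_axioms])
  have False
    if T: "hemiring T" "nonzero T" "is_semiring T" "ideal_simple T"
      and h: "h \<in> hemiring_epi (R\<lparr>carrier := ?I\<rparr>) T"
    for T :: "'a set ring" and h
  proof -
    interpret T: hemiring T by fact
    obtain f where f: "f \<in> hemiring_epi R T" and ext: "\<And>x. x \<in> ?I \<Longrightarrow> f x = h x"
      using ideal_epi_extends [OF assms I h T(3)] by blast
    obtain t where t: "t \<in> carrier T" "t \<noteq> \<zero>\<^bsub>T\<^esub>"
      using T(2) T.zero_closed unfolding nonzero_def by blast
    have "h ` ?I = carrier T" using hemiring_epiD(2) [OF h] by simp
    then obtain x where x: "x \<in> ?I" "f x \<noteq> \<zero>\<^bsub>T\<^esub>"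
      using t ext by (metis imageE)
    have "is_field T \<or> (\<lambda>x. x \<noteq> \<zero>\<^bsub>T\<^esub>) \<in> hemiring_epi T boolean_semifield"
      by (rule ideal_simple_field_or_boolean_image [OF comm_hemiring_epi_image [OF assms f] T(3,4,2)])
    then show False
    proof
      assume "is_field T"
      then have "simple T" by (rule field_simple_semiring(3))
      then show False
        using simple_congruence_radical_vanishes [OF R.hemiring_axioms f T(2,3) _ x(1)] x(2) by simp
    next
      assume g: "(\<lambda>x. x \<noteq> \<zero>\<^bsub>T\<^esub>) \<in> hemiring_epi T boolean_semifield"
      have "((\<lambda>x. x \<noteq> \<zero>\<^bsub>T\<^esub>) \<circ> f) x = \<zero>\<^bsub>boolean_semifield\<^esub>"
        by (rule simple_congruence_radical_vanishes
            [OF R.hemiring_axioms hemiring_epi_comp [OF f g] boolean_semifield_simple_semiring(4,2,3) x(1)])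
      then show False using x(2) by (simp add: boolean_semifield_def)
    qed
  qed
  then have "no_ideal_simple_image (R\<lparr>carrier := ?I\<rparr>)"
    using hemiring_ideal_hemiring [OF R.hemiring_axioms I]
    unfolding no_ideal_simple_image_def by blast
  then show "?I \<subseteq> brown_mccoy_radical R"
    using I unfolding brown_mccoy_radical_def by blast
qed


section \<open>Subdirect representations\<close>

lemma semiiso_subdirect_product_brown_mccoy_radical:
  assumes R: "hemiring R"
    and sub: "semiiso_subdirect_product TYPE('i) (P :: 'b ring \<Rightarrow> bool) R"
    and P: "\<And>Q. P Q \<Longrightarrow> is_semiring Q \<and> ideal_simple Q"
  shows "brown_mccoy_radical R = {\<zero>\<^bsub>R\<^esub>}"
proof -
  interpret R: hemiring R by fact
  obtain I :: "'i set" and Q S where Q: "\<forall>i \<in> I. P (Q i)"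
    and S: "subdirect_product I Q S" and RS: "semiisomorphic R S"
    using sub unfolding semiiso_subdirect_product_def by (elim exE conjE) (rule that)
  obtain C where C: "subhemiring (hemiring_product I Q) C"
    and SC: "S = (hemiring_product I Q)\<lparr>carrier := C\<rparr>"
    and proj: "\<forall>i \<in> I. (\<lambda>x. x i) ` C = carrier (Q i)"
    using S unfolding subdirect_product_def by (elim exE conjE) (rule that)
  obtain h where h: "h \<in> hemiring_epi R S" and ker: "{a \<in> carrier R. h a = \<zero>\<^bsub>S\<^esub>} = {\<zero>\<^bsub>R\<^esub>}"
    using RS by (auto simp: semiisomorphic_def)
  note hom = hemiring_homD [OF hemiring_epiD(1) [OF h]]
  have "x = \<zero>\<^bsub>R\<^esub>" if x: "x \<in> brown_mccoy_radical R" for x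
  proof -
    have xR: "x \<in> carrier R"
      using x by (auto simp: brown_mccoy_radical_def hemiring_ideal_def)
    have "h x i = \<zero>\<^bsub>Q i\<^esub>" if i: "i \<in> I" for i
    proof -
      have "(\<lambda>x. x i) \<in> hemiring_epi S (Q i)"
        using bspec [OF proj i] i
        by (auto simp: hemiring_epi_def hemiring_hom_def SC hemiring_product_def)
      then have "(\<lambda>x. x i) \<circ> h \<in> hemiring_epi R (Q i)"
        by (rule hemiring_epi_comp [OF h])
      from brown_mccoy_radical_vanishes [OF R this _ _ x] P [OF bspec [OF Q i]] show ?thesis by simp
    qed
    moreover have "h x \<in> carrier (hemiring_product I Q)"
      using hom(1) [OF xR] C by (auto simp: SC subhemiring_def)
    ultimately have "h x = \<zero>\<^bsub>S\<^esub>"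
      by (auto simp: SC hemiring_product_def PiE_iff extensional_def restrict_def)
    then show ?thesis using ker xR by blast
  qed
  then show ?thesis using zero_in_brown_mccoy_radical [OF R] by blast
qed

text \<open>
  \<open>R\<close> maps to the product of all its nonzero simple semiring quotients, and the elements sent to
  \<open>0\<close> are those of the congruence radical.
\<close>

lemma semiiso_subdirect_product_of_simple_quotients:
  fixes R :: "('a, 'm) ring_scheme" and P :: "'a set ring \<Rightarrow> bool"
  assumes R: "hemiring R" and rad: "simple_congruence_radical R = {\<zero>\<^bsub>R\<^esub>}"
    and P: "\<And>\<rho>. \<rho> \<in> simple_semiring_congruences R \<Longrightarrow> P (hemiring_quotient R \<rho>)"
  shows "semiiso_subdirect_product TYPE('a rel) P R"
proof -
  interpret R: hemiring R by fact
  let ?I = "simple_semiring_congruences R" and ?Q = "hemiring_quotient R"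
  let ?\<Pi> = "hemiring_product ?I ?Q"
  define h where "h r = (\<lambda>\<rho> \<in> ?I. \<rho> `` {r})" for r
  let ?C = "h ` carrier R"
  have cong: "congruence R \<rho>" if "\<rho> \<in> ?I" for \<rho>
    using that by (simp add: simple_semiring_congruences_def)
  note epi = hemiring_quotient_epi [OF cong]
  note q = hemiring_homD [OF hemiring_epiD(1) [OF epi]]
  have h: "h r \<in> carrier ?\<Pi>" if "r \<in> carrier R" for r
    using q(1) that by (simp add: h_def hemiring_product_def)
  have h0: "h \<zero>\<^bsub>R\<^esub> = \<zero>\<^bsub>?\<Pi>\<^esub>"
    by (simp add: h_def hemiring_product_def q(2) cong: restrict_cong)
  have ha: "h (r \<oplus>\<^bsub>R\<^esub> s) = h r \<oplus>\<^bsub>?\<Pi>\<^esub> h s" and hm: "h (r \<otimes>\<^bsub>R\<^esub> s) = h r \<otimes>\<^bsub>?\<Pi>\<^esub> h s"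
    if "r \<in> carrier R" "s \<in> carrier R" for r s
    using that by (simp_all add: h_def hemiring_product_def q(3,4) cong: restrict_cong)
  have "subhemiring ?\<Pi> ?C"
    unfolding subhemiring_def
  proof (intro conjI ballI)
    show "?C \<subseteq> carrier ?\<Pi>" using h by auto
    show "\<zero>\<^bsub>?\<Pi>\<^esub> \<in> ?C" using h0 by (metis R.zero_closed imageI)
  qed (auto simp: ha [symmetric] hm [symmetric] R.mult_closed)
  moreover have "(\<lambda>x. x \<rho>) ` ?C = carrier (?Q \<rho>)" if "\<rho> \<in> ?I" for \<rho>
    using hemiring_epiD(2) [OF epi [OF that]] that by (simp add: h_def image_image)
  ultimately have "subdirect_product ?I ?Q (?\<Pi>\<lparr>carrier := ?C\<rparr>)"
    unfolding subdirect_product_def by (intro exI [of _ ?C]) simp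
  moreover have "semiisomorphic R (?\<Pi>\<lparr>carrier := ?C\<rparr>)"
    unfolding semiisomorphic_def
  proof (rule bexI [of _ h])
    show "h \<in> hemiring_epi R (?\<Pi>\<lparr>carrier := ?C\<rparr>)"
      by (simp add: hemiring_epi_def hemiring_hom_def h0 ha hm)
    have "h a = \<zero>\<^bsub>?\<Pi>\<^esub> \<longleftrightarrow> a \<in> simple_congruence_radical R" if a: "a \<in> carrier R" for a
    proof -
      have "h a = \<zero>\<^bsub>?\<Pi>\<^esub> \<longleftrightarrow> (\<forall>\<rho> \<in> ?I. \<rho> `` {a} = \<zero>\<^bsub>?Q \<rho>\<^esub>)"
        by (auto simp: h_def hemiring_product_def restrict_def fun_eq_iff)
      also have "\<dots> \<longleftrightarrow> a \<in> simple_congruence_radical R"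
        using a hemiring_quotient_class_zero_iff [OF cong R a]
        by (simp add: simple_congruence_radical_def zero_class_def)
      finally show ?thesis .
    qed
    then show "{a \<in> carrier R. h a = \<zero>\<^bsub>?\<Pi>\<lparr>carrier := ?C\<rparr>\<^esub>} = {\<zero>\<^bsub>R\<^esub>}"
      using rad R.zero_closed by auto
  qed
  ultimately show ?thesis
    using P unfolding semiiso_subdirect_product_def by (intro exI conjI ballI)
qed

theorem corollary3p16:
  fixes R :: "('a, 'm) ring_scheme"
  assumes "comm_hemiring R"
  shows "
    (brown_mccoy_radical R = {\<zero>\<^bsub>R\<^esub>} \<longleftrightarrow> simple_congruence_radical R = {\<zero>\<^bsub>R\<^esub>})
  \<and> (simple_congruence_radical R = {\<zero>\<^bsub>R\<^esub>} \<longleftrightarrow>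
       semiiso_subdirect_product TYPE('a rel) (simple_comm_semiring :: 'a set ring \<Rightarrow> bool) R)
  \<and> (semiiso_subdirect_product TYPE('a rel) (simple_comm_semiring :: 'a set ring \<Rightarrow> bool) R \<longleftrightarrow>
       semiiso_subdirect_product TYPE('a rel) (field_or_boolean :: 'a set ring \<Rightarrow> bool) R)
  \<and> (semiiso_subdirect_product TYPE('i) (simple_comm_semiring :: 'b ring \<Rightarrow> bool) R \<longrightarrow>
       brown_mccoy_radical R = {\<zero>\<^bsub>R\<^esub>})
  \<and> (semiiso_subdirect_product TYPE('i) (field_or_boolean :: 'b ring \<Rightarrow> bool) R \<longrightarrow>
       brown_mccoy_radical R = {\<zero>\<^bsub>R\<^esub>})"
proof -
  interpret R: comm_hemiring R by fact
  have simple_quot: "simple_comm_semiring (hemiring_quotient R \<rho>)"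
      and fb: "field_or_boolean (hemiring_quotient R \<rho>)"
    if \<rho>: "\<rho> \<in> simple_semiring_congruences R" for \<rho>
  proof -
    have "comm_hemiring (hemiring_quotient R \<rho>)"
      using \<rho> by (intro comm_hemiring_epi_image [OF assms hemiring_quotient_epi])
        (simp add: simple_semiring_congruences_def)
    then show "simple_comm_semiring (hemiring_quotient R \<rho>)"
      using \<rho> by (simp add: simple_semiring_congruences_def simple_comm_semiring_def)
    then show "field_or_boolean (hemiring_quotient R \<rho>)"
      using \<rho> by (intro simple_field_or_boolean) (simp_all add: simple_semiring_congruences_def)
  qed
  let "(?bm \<longleftrightarrow> ?cs) \<and> (_ \<longleftrightarrow> ?simple) \<and> (_ \<longleftrightarrow> ?fb) \<and> (?simple' \<longrightarrow> _) \<and> (?fb' \<longrightarrow> _)" = ?thesis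
  note to = semiiso_subdirect_product_of_simple_quotients [OF R.hemiring_axioms]
  note from_any = semiiso_subdirect_product_brown_mccoy_radical [OF R.hemiring_axioms]
  have "?bm \<longleftrightarrow> ?cs"
    by (simp add: brown_mccoy_radical_eq_simple_congruence_radical [OF assms])
  moreover have "?cs \<Longrightarrow> ?simple" by (rule to) (auto intro: simple_quot)
  moreover have "?cs \<Longrightarrow> ?fb" by (rule to) (auto intro: fb)
  moreover have "?simple \<Longrightarrow> ?bm" "?simple' \<Longrightarrow> ?bm"
    by (erule from_any, simp add: simple_comm_semiring_def simple_def)+
  moreover have "?fb \<Longrightarrow> ?bm" "?fb' \<Longrightarrow> ?bm"
    by (erule from_any, simp add: field_or_boolean_ideal_simple_semiring)+
  ultimately show ?thesis by argo
qed

end
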